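(* Let $\alpha\ge 1$ and $0<\epsilon<1$. In the bounded deletion model with parameter $\alpha$, any counter based algorithm needs at least $\frac{\alpha}{\epsilon}$ counters to solve the deterministic frequent items problem with parameter $\epsilon$. That is, if a deterministic counter based algorithm with $k$ counters has the property that, for every stream of $I$ insertions and $D$ deletions with $D\le(1-\frac1\alpha)I$, after processing the stream it reports all items $x$ with $f(x)\ge\epsilon|F|_1$, then $k\ge\frac{\alpha}{\epsilon}$.
   Context: Data stream: a finite sequence of $N\ge1$ unit-weight operations, each being the insertion or the deletion of one item from a universe (no bound on the universe size is assumed). An item may be deleted only if it was previously inserted, so the frequency $f(x)$ = (number of insertions of $x$) $-$ (number of deletions of $x$) is always nonnegative. $I$ is the total number of insertions and $D$ the total number of deletions. $F$ is the vector of all frequencies, so $|F|_1=\sum_x f(x)=I-D$. Bounded deletion model with parameter $\alpha\ge1$: streams with $D\le(1-\frac1\alpha)I$. Deterministic frequent items problem with parameter $\epsilon$: after one pass over the stream, report a collection of items that contains every item $x$ with $f(x)\ge\epsilon|F|_1$. Counter based algorithm with $k$ counters: a one-pass algorithm that tracks a subset of the input items. It maintains at most $k$ pairs (item, count), and its maintenance rule increments or decrements the counts and may replace tracked items, so as to capture the frequencies of the tracked ("monitored") items. It retains no information on the identity of unmonitored items: after an operation, a monitored item is either one that was monitored before the operation or the item of the current operation. Only monitored items can be reported.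
   Formalization: The bound k ≥ α/ε is false in general (α=1, ε=3/4: majority voting needs only k=1); it is proved when α is rational and α/ε is an integer, exactly the cases where it holds, and k ≥ α/ε − 1 is proved for all α ≥ 1, 0<ε<1. *)

theory Defs
  imports Complex_Main
begin

section \<open>Streams of insertions and deletions\<close>

datatype 'a operation = is_Insertion: Insertion (item: 'a) | is_Deletion: Deletion (item: 'a)

definition insertions :: "'a operation list \<Rightarrow> nat" where
  "insertions s = length (filter is_Insertion s)"

definition deletions :: "'a operation list \<Rightarrow> nat" where
  "deletions s = length (filter is_Deletion s)"

definition freq :: "'a operation list \<Rightarrow> 'a \<Rightarrow> int" where
  "freq s x = int (count_list s (Insertion x)) - int (count_list s (Deletion x))"

text \<open>An item is only deleted while a copy of it is present.\<close>

definition valid_stream :: "'a operation list \<Rightarrow> bool" where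
  "valid_stream s \<longleftrightarrow> (\<forall>n x. 0 \<le> freq (take n s) x)"

text \<open>The sum ranges over the finitely many items that occur in the stream; all other
  frequencies are 0.\<close>

definition freq_norm :: "'a operation list \<Rightarrow> int" where
  "freq_norm s = (\<Sum>x\<in>item ` set s. \<bar>freq s x\<bar>)"

definition bounded_deletion :: "real \<Rightarrow> 'a operation list \<Rightarrow> bool" where
  "bounded_deletion \<alpha> s \<longleftrightarrow>
     s \<noteq> [] \<and> valid_stream s \<and> real (deletions s) \<le> (1 - 1 / \<alpha>) * real (insertions s)"


section \<open>Counter based algorithms\<close>

text \<open>The (item, count) pairs form a finite partial map. The second component of a state holds
  whatever else an algorithm records besides the pairs, such as the stream length (for
  \<open>'m = unit\<close>: nothing). It does not count towards the number of counters; the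
  condition on \<open>monitored\<close> in \<open>counter_based\<close> keeps it from being used to recover an
  item that is no longer monitored.\<close>

type_synonym ('a, 'm) state = "('a \<rightharpoonup> int) \<times> 'm"

record ('a, 'm) stream_algorithm =
  initial :: "('a, 'm) state"
  process :: "'a operation \<Rightarrow> ('a, 'm) state \<Rightarrow> ('a, 'm) state"
  report :: "('a, 'm) state \<Rightarrow> 'a set"

definition monitored :: "('a, 'm) state \<Rightarrow> 'a set" where
  "monitored \<sigma> = dom (fst \<sigma>)"

definition run :: "('a, 'm) stream_algorithm \<Rightarrow> 'a operation list \<Rightarrow> ('a, 'm) state" where
  "run A s = fold (process A) s (initial A)"

definition counter_based :: "nat \<Rightarrow> ('a, 'm) stream_algorithm \<Rightarrow> bool" where
  "counter_based k A \<longleftrightarrow>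
     monitored (initial A) = {} \<and>
     (\<forall>s. valid_stream s \<longrightarrow>
        finite (monitored (run A s)) \<and> card (monitored (run A s)) \<le> k \<and>
        report A (run A s) \<subseteq> monitored (run A s)) \<and>
     (\<forall>s oper. valid_stream (s @ [oper]) \<longrightarrow>
        monitored (run A (s @ [oper])) \<subseteq> insert (item oper) (monitored (run A s)))"

definition solves_frequent_items ::
    "real \<Rightarrow> real \<Rightarrow> ('a, 'm) stream_algorithm \<Rightarrow> bool" where
  "solves_frequent_items \<alpha> \<epsilon> A \<longleftrightarrow>
     (\<forall>s. bounded_deletion \<alpha> s \<longrightarrow>
        {x. real_of_int (freq s x) \<ge> \<epsilon> * real_of_int (freq_norm s)} \<subseteq> report A (run A s))"


section \<open>Fewer than \<open>\<alpha> / \<epsilon>\<close> counters can suffice\<close>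

text \<open>The Misra--Gries algorithm, which here ignores deletions. It shows that the bound
  \<open>\<alpha> / \<epsilon> \<le> k\<close> on the number \<open>k\<close> of counters fails unless \<open>\<alpha>\<close> is
  rational and \<open>\<alpha> / \<epsilon>\<close> is an integer: in all other cases
  \<open>\<lceil>\<alpha> / \<epsilon>\<rceil> - 1\<close> counters are enough. A lower bound for all real
  parameters therefore has to be stated as \<open>\<alpha> / \<epsilon> - 1 \<le> k\<close>. For \<open>\<alpha> = 1\<close>, \<open>\<epsilon> = 3/4\<close>
  this is majority voting with a single counter.\<close>

definition count_of :: "('a \<rightharpoonup> int) \<Rightarrow> 'a \<Rightarrow> int" where
  "count_of c x = (case c x of None \<Rightarrow> 0 | Some n \<Rightarrow> n)"

fun misra_gries_step :: "nat \<Rightarrow> 'a operation \<Rightarrow> ('a, unit) state \<Rightarrow> ('a, unit) state" where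
  "misra_gries_step k (Deletion x) \<sigma> = \<sigma>"
| "misra_gries_step k (Insertion x) (c, u) =
     (if x \<in> dom c \<or> card (dom c) < k then c(x \<mapsto> count_of c x + 1)
      else (\<lambda>y. if count_of c y > 1 then Some (count_of c y - 1) else None), u)"

definition misra_gries :: "nat \<Rightarrow> ('a, unit) stream_algorithm" where
  "misra_gries k = \<lparr>initial = (Map.empty, ()), process = misra_gries_step k, report = monitored\<rparr>"

lemma process_misra_gries: "process (misra_gries k) = misra_gries_step k"
  by (simp add: misra_gries_def)

lemma run_snoc: "run A (s @ [oper]) = process A oper (run A s)"
  by (simp add: run_def)

lemma misra_gries_invariant:
  fixes s :: "'a operation list" and k :: nat
  defines "c \<equiv> fst (run (misra_gries k) s)"
  shows "finite (dom c) \<and> card (dom c) \<le> k \<and> (\<forall>x\<in>dom c. count_of c x \<ge> 1) \<and>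
    (\<exists>d\<ge>0. (int k + 1) * d + (\<Sum>x\<in>dom c. count_of c x) \<le> int (insertions s) \<and>
       (\<forall>x. int (count_list s (Insertion x)) \<le> count_of c x + d))"
  unfolding c_def
proof (induction s rule: rev_induct)
  case Nil
  then show ?case by (auto simp: run_def misra_gries_def insertions_def count_of_def intro!: exI[of _ 0])
next
  case (snoc oper s)
  define c where "c = fst (run (misra_gries k) s)"
  define c' where "c' = fst (run (misra_gries k) (s @ [oper]))"
  from snoc obtain d where fin: "finite (dom c)" and card: "card (dom c) \<le> k"
    and pos: "\<And>x. x \<in> dom c \<Longrightarrow> count_of c x \<ge> 1" and d: "d \<ge> 0"
    and tot: "(int k + 1) * d + (\<Sum>x\<in>dom c. count_of c x) \<le> int (insertions s)"
    and est: "\<And>x. int (count_list s (Insertion x)) \<le> count_of c x + d"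
    unfolding c_def by blast
  have zero: "count_of c x = 0" if "x \<notin> dom c" for x
    using that by (auto simp: count_of_def domIff)
  have "run (misra_gries k) s = (c, ())"
    by (simp add: c_def prod_eq_iff)
  then have c': "c' = fst (misra_gries_step k oper (c, ()))"
    by (simp add: c'_def run_snoc process_misra_gries)
  have "finite (dom c') \<and> card (dom c') \<le> k \<and> (\<forall>x\<in>dom c'. count_of c' x \<ge> 1) \<and>
    (\<exists>d\<ge>0. (int k + 1) * d + (\<Sum>x\<in>dom c'. count_of c' x) \<le> int (insertions (s @ [oper])) \<and>
       (\<forall>x. int (count_list (s @ [oper]) (Insertion x)) \<le> count_of c' x + d))"
  proof (cases oper)
    case (Deletion x)
    then have "c' = c" by (simp add: c')
    with Deletion fin card pos d tot est show ?thesis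
      by (auto simp: insertions_def)
  next
    case (Insertion x)
    have ins: "insertions (s @ [oper]) = insertions s + 1"
      by (simp add: insertions_def Insertion)
    show ?thesis
    proof (cases "x \<in> dom c \<or> card (dom c) < k")
      case True
      then have c'_eq: "c' = c(x \<mapsto> count_of c x + 1)" by (simp add: c' Insertion)
      then have dom': "dom c' = insert x (dom c)" by auto
      have cnt: "count_of c' y = count_of c y + (if y = x then 1 else 0)" for y
        by (simp add: c'_eq count_of_def)
      have "card (dom c') \<le> k"
        using True fin card by (auto simp: dom' card_insert_if)
      moreover have "count_of c' y \<ge> 1" if "y \<in> dom c'" for y
        using that pos[of y] zero[of y] by (cases "y \<in> dom c") (auto simp: dom' cnt)
      moreover have "(\<Sum>y\<in>dom c'. count_of c' y) = (\<Sum>y\<in>dom c. count_of c y) + 1"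
      proof -
        have "(\<Sum>y\<in>dom c'. count_of c' y) =
            (\<Sum>y\<in>insert x (dom c). count_of c y) + (\<Sum>y\<in>insert x (dom c). if y = x then 1 else 0)"
          by (simp only: dom' cnt sum.distrib)
        also have "(\<Sum>y\<in>insert x (dom c). if y = x then 1 else 0) = (1::int)"
          using fin by (simp add: sum.delta)
        also have "(\<Sum>y\<in>insert x (dom c). count_of c y) = (\<Sum>y\<in>dom c. count_of c y)"
          using fin zero by (cases "x \<in> dom c") (auto simp: insert_absorb)
        finally show ?thesis .
      qed
      moreover have "int (count_list (s @ [oper]) (Insertion y)) \<le> count_of c' y + d" for y
        using est[of y] by (auto simp: cnt Insertion)
      ultimately show ?thesis
        using d tot fin by (auto simp: dom' ins simp del: count_list_append intro!: exI[of _ d])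
    next
      case False
      then have x: "x \<notin> dom c" and k: "card (dom c) = k" using card by auto
      have c'_eq: "c' = (\<lambda>y. if count_of c y > 1 then Some (count_of c y - 1) else None)"
        using False by (simp add: c' Insertion)
      have sub: "dom c' \<subseteq> dom c"
        using zero by (fastforce simp: c'_eq dom_def split: if_splits)
      have cnt: "count_of c' y = count_of c y - 1" if "y \<in> dom c" for y
        using pos[OF that] by (auto simp: c'_eq count_of_def)
      have cnt0: "count_of c' y \<ge> count_of c y - 1" for y
        by (cases "count_of c y > 1") (simp_all add: c'_eq count_of_def[of "\<lambda>z. _ z"])
      have "(\<Sum>y\<in>dom c'. count_of c' y) = (\<Sum>y\<in>dom c. count_of c' y)"
        by (rule sum.mono_neutral_left) (use fin sub in \<open>auto simp: count_of_def domIff\<close>)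
      also have "\<dots> = (\<Sum>y\<in>dom c. count_of c y) - int k"
        by (simp add: cnt sum_subtractf k)
      finally have "(int k + 1) * (d + 1) + (\<Sum>y\<in>dom c'. count_of c' y) \<le> int (insertions s) + 1"
        using tot by (simp add: algebra_simps)
      moreover have "int (count_list (s @ [oper]) (Insertion y)) \<le> count_of c' y + (d + 1)" for y
      proof (cases "y = x")
        case True
        have "count_of c' x \<ge> 0" by (simp add: c'_eq count_of_def)
        with True est[of x] zero[OF x] show ?thesis by (simp add: Insertion)
      next
        case False
        with est[of y] cnt0[of y] show ?thesis by (auto simp: Insertion)
      qed
      moreover have "count_of c' y \<ge> 1" if "y \<in> dom c'" for y
        using that by (auto simp: c'_eq count_of_def dom_def split: if_splits)
      moreover have "finite (dom c')" "card (dom c') \<le> k"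
        using sub fin k finite_subset card_mono by blast+
      ultimately show ?thesis
        using d by (auto simp: ins simp del: count_list_append intro!: exI[of _ "d + 1"])
    qed
  qed
  then show ?case by (simp add: c'_def)
qed

lemma insertions_minus_deletions:
  "int (insertions s) - int (deletions s) = (\<Sum>x\<in>item ` set s. freq s x)"
proof -
  have "int (insertions s) - int (deletions s) = (\<Sum>x\<in>X. freq s x)"
    if "finite X" "item ` set s \<subseteq> X" for X
    using that(2)
  proof (induction s)
    case Nil
    then show ?case by (simp add: insertions_def deletions_def freq_def)
  next
    case (Cons oper s)
    have "freq (oper # s) x = freq s x +
        (if x = item oper then (if is_Insertion oper then 1 else -1) else 0)" for x
      by (cases oper) (auto simp: freq_def)
    then have "(\<Sum>x\<in>X. freq (oper # s) x) = (\<Sum>x\<in>X. freq s x) + (if is_Insertion oper then 1 else -1)"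
      using Cons.prems that(1) by (simp add: sum.distrib sum.delta)
    then show ?case
      using Cons by (cases oper) (auto simp: insertions_def deletions_def)
  qed
  then show ?thesis by blast
qed

theorem misra_gries_counter_based: "counter_based k (misra_gries k)"
  unfolding counter_based_def
proof (intro conjI allI impI)
  show "monitored (initial (misra_gries k)) = {}"
    by (simp add: misra_gries_def monitored_def)
next
  fix s :: "'a operation list"
  show "finite (monitored (run (misra_gries k) s))" "card (monitored (run (misra_gries k) s)) \<le> k"
    using misra_gries_invariant[of k s] by (auto simp: monitored_def)
  show "report (misra_gries k) (run (misra_gries k) s) \<subseteq> monitored (run (misra_gries k) s)"
    by (simp add: misra_gries_def)
next
  fix s :: "'a operation list" and oper
  obtain c where c: "run (misra_gries k) s = (c, ())" by (cases "run (misra_gries k) s") auto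
  have "dom (\<lambda>y. if count_of c y > 1 then Some (count_of c y - 1) else None) \<subseteq> dom c"
    by (auto simp: count_of_def dom_def split: if_splits option.splits)
  then show "monitored (run (misra_gries k) (s @ [oper]))
      \<subseteq> insert (item oper) (monitored (run (misra_gries k) s))"
    by (cases oper) (auto simp: run_snoc process_misra_gries c monitored_def split: if_splits)
qed

theorem misra_gries_below_bound:
  assumes "1 \<le> \<alpha>" "0 < \<epsilon>" and exception: "\<not> (\<alpha> \<in> \<rat> \<and> \<alpha> / \<epsilon> \<in> \<int>)"
  obtains k where "real k < \<alpha> / \<epsilon>"
    and "counter_based k (misra_gries k :: ('a, unit) stream_algorithm)"
    and "solves_frequent_items \<alpha> \<epsilon> (misra_gries k :: ('a, unit) stream_algorithm)"
proof
  define k where "k = nat (\<lceil>\<alpha> / \<epsilon>\<rceil> - 1)"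
  have "\<alpha> / \<epsilon> > 0" using assms by simp
  then have ge: "real k + 1 \<ge> \<alpha> / \<epsilon>" and "real k < \<alpha> / \<epsilon>"
    unfolding k_def by linarith+
  then show "real k < \<alpha> / \<epsilon>" by simp
  show "counter_based k (misra_gries k :: ('a, unit) stream_algorithm)"
    by (rule misra_gries_counter_based)
  show "solves_frequent_items \<alpha> \<epsilon> (misra_gries k :: ('a, unit) stream_algorithm)"
    unfolding solves_frequent_items_def
  proof (intro allI impI subsetI)
    fix s :: "'a operation list" and x
    assume s: "bounded_deletion \<alpha> s"
      and "x \<in> {x. real_of_int (freq s x) \<ge> \<epsilon> * real_of_int (freq_norm s)}"
    then have x: "real_of_int (freq s x) \<ge> \<epsilon> * real_of_int (freq_norm s)" by simp
    let ?I = "insertions s" and ?D = "deletions s"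
    from s have ne: "s \<noteq> []" and val: "\<And>n y. 0 \<le> freq (take n s) y"
      and del: "real ?D \<le> (1 - 1 / \<alpha>) * real ?I"
      by (auto simp: bounded_deletion_def valid_stream_def)
    have "freq s y \<ge> 0" for y using val[of "length s" y] by simp
    then have norm: "freq_norm s = int ?I - int ?D"
      by (simp add: freq_norm_def insertions_minus_deletions)
    have len: "?I + ?D = length s"
    proof -
      have "filter is_Deletion s = filter (\<lambda>y. \<not> is_Insertion y) s"
        by (rule filter_cong) (auto simp: operation.disc_eq_case split: operation.splits)
      then show ?thesis
        unfolding insertions_def deletions_def by (simp add: sum_length_filter_compl)
    qed
    have I: "?I > 0"
    proof (rule ccontr)
      assume "\<not> ?I > 0"
      with del len ne show False by simp
    qed
    have F: "real_of_int (freq_norm s) * \<alpha> \<ge> real ?I"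
      using del assms by (simp add: norm field_simps)
    show "x \<in> report (misra_gries k) (run (misra_gries k) s)"
    proof (rule ccontr)
      assume nx: "x \<notin> report (misra_gries k) (run (misra_gries k) s)"
      define c where "c = fst (run (misra_gries k) s)"
      have c: "c x = None" using nx by (simp add: misra_gries_def monitored_def c_def domIff)
      from misra_gries_invariant[of k s, folded c_def] obtain d where
        pos: "\<forall>x\<in>dom c. count_of c x \<ge> 1"
        and tot: "(int k + 1) * d + (\<Sum>x\<in>dom c. count_of c x) \<le> int ?I"
        and est: "int (count_list s (Insertion x)) \<le> count_of c x + d"
        by blast
      have "(\<Sum>x\<in>dom c. count_of c x) \<ge> 0" using pos by (intro sum_nonneg) force
      with tot have "(int k + 1) * d \<le> int ?I" by linarith
      moreover have "freq s x \<le> d" using est c by (simp add: freq_def count_of_def)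
      ultimately have "(int k + 1) * freq s x \<le> int ?I"
        by (smt (verit) mult_left_mono of_nat_0_le_iff)
      then have up: "(real k + 1) * real_of_int (freq s x) \<le> real ?I"
        by (metis (mono_tags, opaque_lifting) of_int_1 of_int_add of_int_le_iff of_int_mult of_int_of_nat_eq)
      have Fpos: "real_of_int (freq_norm s) > 0"
        using F I assms by (smt (verit) mult_nonpos_nonneg of_nat_0_less_iff)
      have e1: "(real k + 1) * real_of_int (freq s x) \<ge> (real k + 1) * (\<epsilon> * real_of_int (freq_norm s))"
        using x by (intro mult_left_mono) auto
      have e2: "(real k + 1) * (\<epsilon> * real_of_int (freq_norm s)) \<ge> \<alpha> * real_of_int (freq_norm s)"
      proof -
        have "(real k + 1) * \<epsilon> \<ge> \<alpha>" using ge assms by (simp add: field_simps)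
        then show ?thesis using Fpos by (metis mult.assoc mult_right_mono less_imp_le)
      qed
      have e3: "\<alpha> * real_of_int (freq_norm s) \<ge> real ?I" using F by (simp add: mult.commute)
      have eqs: "(real k + 1) * (\<epsilon> * real_of_int (freq_norm s)) = \<alpha> * real_of_int (freq_norm s)"
        "\<alpha> * real_of_int (freq_norm s) = real ?I"
        using up e1 e2 e3 by linarith+
      have "(real k + 1) * \<epsilon> = \<alpha>" using eqs(1) Fpos by simp
      then have "\<alpha> / \<epsilon> = of_int (int k + 1)" using assms by (simp add: field_simps)
      then have "\<alpha> / \<epsilon> \<in> \<int>" by (metis Ints_of_int)
      moreover have "\<alpha> = of_nat ?I / of_int (freq_norm s)" using eqs(2) Fpos by (simp add: field_simps)
      then have "\<alpha> \<in> \<rat>" by simp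
      ultimately show False using exception by blast
    qed
  qed
qed

end

(* An adversary inserts t copies of each of L > k items. Some item x is then unmonitored, and it
   stays so while copies of the other items are deleted, because only the item of the current
   operation can become monitored. Deleting until M items are left, where M is at least
   L t / \<alpha>, at least t and at most t / \<epsilon>, makes x a frequent item that cannot be reported.
   For L < \<alpha> / \<epsilon> a suitable M exists once t is large; for L = \<alpha> / \<epsilon> it has to be
   exactly L t / \<alpha>, which is an integer for some t if \<alpha> is rational. *)
theory Submission
  imports Defs
begin

section \<open>Frequencies in streams of insertions followed by deletions\<close>

lemma freq_append: "freq (s @ u) x = freq s x + freq u x"
  by (simp add: freq_def)

lemma freq_map_Insertion: "freq (map Insertion a) x = int (count_list a x)"
  by (induction a) (auto simp: freq_def)

lemma freq_map_Deletion: "freq (map Deletion b) x = - int (count_list b x)"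
  by (induction b) (auto simp: freq_def)

lemma count_list_take_le: "count_list (take n b) x \<le> count_list b x"
  by (metis append_take_drop_id count_list_append le_add1)

lemma insertions_then_deletions:
  "insertions (map Insertion a @ map Deletion b) = length a"
  "deletions (map Insertion a @ map Deletion b) = length b"
  by (simp_all add: insertions_def deletions_def filter_map o_def)

text \<open>During the deletion phase a prefix of \<open>b\<close> removes no more copies than all
  of \<open>b\<close>, so comparing total counts suffices and the order within \<open>a\<close> and
  \<open>b\<close> does not matter.\<close>

lemma valid_insertions_then_deletions:
  assumes "\<And>x. count_list b x \<le> count_list a x"
  shows "valid_stream (map Insertion a @ map Deletion b)"
  unfolding valid_stream_def
proof (intro allI)
  fix n x
  show "0 \<le> freq (take n (map Insertion a @ map Deletion b)) x"
  proof (cases "n \<le> length a")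
    case True
    then show ?thesis by (simp add: take_map freq_map_Insertion)
  next
    case False
    then show ?thesis
      using order_trans[OF count_list_take_le assms, of "n - length a" x]
      by (simp add: take_map freq_append freq_map_Insertion freq_map_Deletion)
  qed
qed

lemma valid_stream_prefix: "valid_stream (s @ u) \<Longrightarrow> valid_stream s"
  unfolding valid_stream_def
  by (metis append_take_drop_id append_eq_conv_conj take_append take_take)

lemma freq_norm_valid:
  assumes "valid_stream s"
  shows "freq_norm s = int (insertions s) - int (deletions s)"
proof -
  have "0 \<le> freq s x" for x
    using assms unfolding valid_stream_def by (metis take_all_iff order_refl)
  then show ?thesis by (simp add: freq_norm_def insertions_minus_deletions)
qed

section \<open>Unmonitored items stay unmonitored and unreported\<close>

lemma unmonitored_append:
  assumes "counter_based k A" "x \<notin> monitored (run A s)"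
    and "valid_stream (s @ u)" "x \<notin> item ` set u"
  shows "x \<notin> monitored (run A (s @ u))"
  using assms(3,4)
proof (induction u rule: rev_induct)
  case Nil
  then show ?case using assms(2) by simp
next
  case (snoc oper u)
  from snoc.prems have valid: "valid_stream ((s @ u) @ [oper])" by simp
  with assms(1) have "monitored (run A ((s @ u) @ [oper])) \<subseteq>
      insert (item oper) (monitored (run A (s @ u)))"
    unfolding counter_based_def by blast
  moreover have "x \<notin> monitored (run A (s @ u))"
    using snoc.IH snoc.prems valid_stream_prefix[OF valid] by simp
  ultimately show ?case using snoc.prems by auto
qed

text \<open>Deleting \<open>b\<close> never touches \<open>x\<close>, so \<open>x\<close> keeps all
  its copies yet cannot be reported at the end. The norm is then the number of insertions minus the
  number of deletions.\<close>

lemma unmonitored_item_infrequent: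
  assumes "counter_based k A" "solves_frequent_items \<alpha> \<epsilon> A"
    and "x \<notin> monitored (run A (map Insertion a))"
    and "\<And>y. count_list b y \<le> count_list a y" "x \<notin> set b"
    and "a \<noteq> []" "real (length b) \<le> (1 - 1 / \<alpha>) * real (length a)"
  shows "real (count_list a x) < \<epsilon> * (real (length a) - real (length b))"
proof (rule ccontr)
  let ?s = "map Insertion a @ map Deletion b"
  assume frequent: "\<not> ?thesis"
  have valid: "valid_stream ?s"
    using assms(4) by (rule valid_insertions_then_deletions)
  have "bounded_deletion \<alpha> ?s"
    using assms(6,7) valid by (simp add: bounded_deletion_def insertions_then_deletions)
  moreover have "real_of_int (freq ?s x) \<ge> \<epsilon> * real_of_int (freq_norm ?s)"
    using frequent assms(5)
    by (simp add: freq_norm_valid[OF valid] insertions_then_deletions freq_append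
        freq_map_Insertion freq_map_Deletion count_list_0_iff)
  ultimately have "x \<in> report A (run A ?s)"
    using assms(2) unfolding solves_frequent_items_def by blast
  moreover have "report A (run A ?s) \<subseteq> monitored (run A ?s)"
    using assms(1) valid unfolding counter_based_def by blast
  moreover have "x \<notin> monitored (run A ?s)"
    by (rule unmonitored_append[OF assms(1,3) valid]) (use assms(5) in auto)
  ultimately show False by blast
qed

section \<open>The adversarial stream with free parameters\<close>

lemma count_list_concat_replicate:
  "count_list (concat (map (replicate t) xs)) x = t * count_list xs x"
proof (induction xs)
  case (Cons y xs)
  have "count_list (replicate t y) x = (if x = y then t else 0)"
    by (induction t) auto
  with Cons show ?case by auto
qed simp

lemma count_list_distinct: "distinct xs \<Longrightarrow> x \<in> set xs \<Longrightarrow> count_list xs x = 1"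
  by (induction xs) (auto simp: count_list_0_iff)

lemma length_concat_replicate: "length (concat (map (replicate t) xs)) = length xs * t"
  by (induction xs) auto

text \<open>Reduces the bound to arithmetic. With \<open>M\<close> items left,
  \<open>t \<le> M\<close> ensures enough copies of items other than the unmonitored one to delete,
  \<open>M \<le> L * t\<close> makes the number \<open>L * t - M\<close> of deletions exact, the
  next condition is bounded deletion, and the last makes an item with \<open>t\<close> copies
  frequent.\<close>

lemma counters_lower_bound:
  fixes A :: "('a, 'm) stream_algorithm" and L t M :: nat
  assumes "infinite (UNIV :: 'a set)" "counter_based k A" "solves_frequent_items \<alpha> \<epsilon> A"
    and "1 \<le> \<alpha>" "0 < t"
    and "t \<le> M" "M \<le> L * t" "real (L * t) / \<alpha> \<le> real M" "\<epsilon> * real M \<le> real t"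
  shows "L \<le> k"
proof (rule ccontr)
  assume "\<not> L \<le> k"
  obtain X :: "'a set" where "finite X" "card X = L"
    using infinite_arbitrarily_large[OF assms(1)] by blast
  then obtain xs where xs: "set xs = X" "distinct xs" "length xs = L"
    using finite_distinct_list distinct_card by metis
  define a where "a = concat (map (replicate t) xs)"
  have len_a: "length a = L * t"
    by (simp add: a_def length_concat_replicate xs(3))
  have "valid_stream (map Insertion a)"
    using valid_insertions_then_deletions[of "[]" a] by simp
  with assms(2) have fin: "finite (monitored (run A (map Insertion a)))"
    and "card (monitored (run A (map Insertion a))) \<le> k"
    unfolding counter_based_def by blast+
  then have "\<not> X \<subseteq> monitored (run A (map Insertion a))"
    using \<open>card X = L\<close> \<open>\<not> L \<le> k\<close> card_mono[OF fin, of X] by linarith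
  then obtain x where x: "x \<in> X" "x \<notin> monitored (run A (map Insertion a))"
    by blast
  have count_x: "count_list a x = t"
    using x(1) xs by (simp add: a_def count_list_concat_replicate count_list_distinct)
  define b where "b = take (L * t - M) (filter (\<lambda>y. x \<noteq> y) a)"
  have "count_list (filter (\<lambda>y. x \<noteq> y) a) y \<le> count_list a y" for y
    by (induction a) auto
  then have count_b: "count_list b y \<le> count_list a y" for y
    unfolding b_def by (rule order_trans[OF count_list_take_le])
  have "x \<notin> set b"
    by (auto simp: b_def dest: in_set_takeD)
  \<comment> \<open>The other items contribute \<open>L * t - t\<close> copies, at least the
    \<open>L * t - M\<close> requested, so \<open>take\<close> does not run short.\<close>
  have "t + length (filter (\<lambda>y. x \<noteq> y) a) = L * t"
    using sum_length_filter_compl[of "\<lambda>y. x = y" a] count_x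
    by (simp add: count_list_eq_length_filter len_a)
  then have "length b = L * t - M"
    using assms(6) by (simp add: b_def)
  then have len_b: "real (length b) = real (length a) - real M"
    using assms(7) by (simp add: len_a of_nat_diff)
  have "real (length b) \<le> (1 - 1 / \<alpha>) * real (length a)"
    using assms(8) unfolding len_b len_a by (simp add: algebra_simps)
  moreover have "a \<noteq> []"
    using count_x assms(5) by auto
  ultimately have "real (count_list a x) < \<epsilon> * (real (length a) - real (length b))"
    using unmonitored_item_infrequent[OF assms(2,3) x(2) count_b \<open>x \<notin> set b\<close>] by blast
  then show False
    using assms(9) by (simp add: count_x len_b)
qed

section \<open>Choice of the parameters\<close>

lemma counters_lower_bound_strict:
  fixes A :: "('a, 'm) stream_algorithm" and L :: nat
  assumes "infinite (UNIV :: 'a set)" "counter_based k A" "solves_frequent_items \<alpha> \<epsilon> A"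
    and "1 \<le> \<alpha>" "0 < \<epsilon>" "\<epsilon> < 1" "real L < \<alpha> / \<epsilon>"
  shows "L \<le> k"
proof (cases "L = 0")
  case False
  \<comment> \<open>\<open>\<delta>\<close> is the relative slack in
    \<open>L < \<alpha> / \<epsilon>\<close>. Rounding \<open>L * t / \<alpha>\<close> up to
    \<open>c\<close> raises \<open>\<epsilon> * c\<close> by less than \<open>\<epsilon>\<close>,
    which the slack \<open>\<delta> * t\<close> absorbs once
    \<open>t > \<epsilon> / \<delta>\<close>.\<close>
  define \<delta> where "\<delta> = 1 - \<epsilon> * real L / \<alpha>"
  have "\<delta> > 0"
    using assms by (simp add: \<delta>_def field_simps)
  obtain t :: nat where t: "\<epsilon> / \<delta> < real t"
    using reals_Archimedean2 by blast
  have "0 < \<epsilon> / \<delta>"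
    using \<open>\<delta> > 0\<close> assms(5) by simp
  with t have "0 < t" by linarith
  define c where "c = nat \<lceil>real (L * t) / \<alpha>\<rceil>"
  have "0 \<le> real (L * t) / \<alpha>"
    using assms(4) by simp
  then have c: "real (L * t) / \<alpha> \<le> real c" "real c < real (L * t) / \<alpha> + 1"
    unfolding c_def by linarith+
  have "real (L * t) / \<alpha> \<le> real (L * t)"
    using assms(4) divide_left_mono[of 1 \<alpha> "real (L * t)"] by simp
  then have "c \<le> L * t"
    unfolding c_def by linarith
  have "\<epsilon> * real c \<le> \<epsilon> * (real (L * t) / \<alpha> + 1)"
    using c(2) assms(5) by (intro mult_left_mono) auto
  also have "\<dots> = real t - (\<delta> * real t - \<epsilon>)"
    by (simp add: \<delta>_def algebra_simps)
  also have "\<dots> \<le> real t"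
    using t \<open>\<delta> > 0\<close> by (simp add: field_simps)
  finally have "\<epsilon> * real c \<le> real t" .
  moreover have "\<epsilon> * real t \<le> real t"
    using assms(5,6) by (simp add: mult_left_le_one_le)
  ultimately have "\<epsilon> * real (max t c) \<le> real t"
    by (simp add: max_def)
  \<comment> \<open>The maximum also secures \<open>t \<le> M\<close>; it stays below
    \<open>L * t\<close> because \<open>L\<close> is positive.\<close>
  then show ?thesis
    using counters_lower_bound[OF assms(1-4) \<open>0 < t\<close>, of "max t c" L] \<open>c \<le> L * t\<close> c(1) False
    by simp
qed simp

text \<open>Here \<open>L * t / \<alpha> = t / \<epsilon>\<close> leaves no room for rounding.
  Writing \<open>\<alpha> = p / q\<close> and taking \<open>t = p\<close> makes this common value
  the integer \<open>L * q\<close>, which serves as \<open>M\<close>.\<close>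

lemma counters_lower_bound_exact:
  fixes A :: "('a, 'm) stream_algorithm" and L :: nat
  assumes "infinite (UNIV :: 'a set)" "counter_based k A" "solves_frequent_items \<alpha> \<epsilon> A"
    and "1 \<le> \<alpha>" "0 < \<epsilon>" "\<epsilon> < 1" "real L = \<alpha> / \<epsilon>" "\<alpha> \<in> \<rat>"
  shows "L \<le> k"
proof -
  obtain p q :: nat where "q \<noteq> 0" and "\<bar>\<alpha>\<bar> = real p / real q"
    using Rats_abs_nat_div_natE[OF assms(8)] by metis
  then have p: "real p = \<alpha> * real q"
    using assms(4) by (simp add: field_simps)
  \<comment> \<open>\<open>q \<le> p\<close> gives \<open>M \<le> L * t\<close>; below,
    \<open>\<epsilon> < 1\<close> gives \<open>p \<le> L * q\<close>, that is
    \<open>t \<le> M\<close>.\<close>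
  then have "real q \<le> real p"
    using assms(4) \<open>q \<noteq> 0\<close> by (simp add: mult_le_cancel_right1)
  then have "q \<le> p" by simp
  have L: "\<epsilon> * real L = \<alpha>"
    using assms(5,7) by simp
  then have "\<alpha> \<le> real L"
    using assms(4-6) by (metis mult_left_le_one_le of_nat_0_le_iff less_imp_le)
  then have "real p \<le> real (L * q)"
    unfolding p by (simp add: mult_right_mono)
  then have "p \<le> L * q"
    by linarith
  moreover have "real (L * p) / \<alpha> = real (L * q)"
    using assms(4) by (simp add: p)
  moreover have "\<epsilon> * real (L * q) = real p"
    using L by (simp add: p mult.assoc[symmetric])
  ultimately show ?thesis
    using counters_lower_bound[OF assms(1-4), of p "L * q" L] \<open>q \<le> p\<close> \<open>q \<noteq> 0\<close> by simp
qed

text \<open>The exact choice of parameters yields the first conjunct and the strict one the second;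
  \<open>misra_gries_below_bound\<close> shows why the full bound is confined to the first case.
  Over at most \<open>k\<close> items an algorithm could monitor everything, hence the infinite
  universe.\<close>

theorem theorem1:
  fixes A :: "('a, 'm) stream_algorithm" and k :: nat and \<alpha> \<epsilon> :: real
  assumes "infinite (UNIV :: 'a set)"
    and "1 \<le> \<alpha>" and "0 < \<epsilon>" and "\<epsilon> < 1"
    and "counter_based k A"
    and "solves_frequent_items \<alpha> \<epsilon> A"
  shows "(\<alpha> \<in> \<rat> \<and> \<alpha> / \<epsilon> \<in> \<int> \<longrightarrow> real k \<ge> \<alpha> / \<epsilon>) \<and> real k \<ge> \<alpha> / \<epsilon> - 1"
proof (intro conjI impI)
  assume rational: "\<alpha> \<in> \<rat> \<and> \<alpha> / \<epsilon> \<in> \<int>"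
  moreover have "0 \<le> \<alpha> / \<epsilon>"
    using assms(2,3) by simp
  ultimately obtain L :: nat where "\<alpha> / \<epsilon> = real L"
    by (metis Ints_cases nonneg_int_cases of_int_0_le_iff of_int_of_nat_eq)
  then show "real k \<ge> \<alpha> / \<epsilon>"
    using counters_lower_bound_exact[OF assms(1,5,6,2,3,4)] rational by simp
next
  show "real k \<ge> \<alpha> / \<epsilon> - 1"
  proof (rule ccontr)
    assume "\<not> ?thesis"
    \<comment> \<open>With \<open>L = Suc k\<close> the strict case would give
      \<open>Suc k \<le> k\<close>.\<close>
    then have "real (Suc k) < \<alpha> / \<epsilon>" by simp
    then show False
      using counters_lower_bound_strict[OF assms(1,5,6,2,3,4)] by fastforce
  qed
qed

end
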